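(* Assume that $(\alpha_p,\alpha_e)=(0,1)$ and that $\kappa>2$ is an integer. Then $\mathbf{G}^2_{22}(\kappa,\rho,\mathcal{E})>0$ for any $\rho\in(0,1)$ and $\mathcal{E}\in(\rho,\kappa\rho)$. Moreover, if $0<\rho<1-\frac2\kappa$, there exists an energy value $\mathcal{E}^\star=\mathcal{E}^\star(\kappa,\rho)\in(\rho,\kappa\rho)$ for which $\mathbf{G}^1_{11}(\kappa,\rho,\mathcal{E}^\star)=0$.
   Context: Let $$\chi(\rho,\mathcal{E})=\begin{pmatrix}\rho(1-\rho)&\mathcal{E}(1-\rho)\\ \mathcal{E}(1-\rho)&\frac{(\mathcal{E}-\rho)(\kappa\rho-\mathcal{E})}{(\kappa-1)\rho}+\frac{(1-\rho)\mathcal{E}^2}{\rho}\end{pmatrix},\qquad \mathbf{j}(\rho,\mathcal{E})=(\kappa-1)\chi(\rho,\mathcal{E})\begin{pmatrix}\alpha_p\\ \alpha_e\end{pmatrix}.$$ $\mathbf{J}$ is the Jacobian matrix of $\mathbf{j}$ with respect to $(\rho,\mathcal{E})$ and $\mathbf{H}^i$ ($i=1,2$) is the Hessian matrix of the coordinate $\mathbf{j}_i$. When $\alpha_e\neq0$, $\mathbf{J}$ has two distinct real eigenvalues $\lambda_1>\lambda_2$, with left eigenvectors normalized as $\begin{pmatrix}\mathfrak{c}_i&1\end{pmatrix}\mathbf{J}=\lambda_i\begin{pmatrix}\mathfrak{c}_i&1\end{pmatrix}$, $\mathfrak{c}_1\ne\mathfrak{c}_2$. Put $R=\begin{pmatrix}\mathfrak{c}_1&1\\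 \mathfrak{c}_2&1\end{pmatrix}$. The coupling matrices are $$\mathbf{G}^i=\frac12(R^{-1})^\top(\mathfrak{c}_i\mathbf{H}^1+\mathbf{H}^2)R^{-1},\qquad i=1,2,$$ and $\mathbf{G}^i_{jk}(\kappa,\rho,\mathcal{E})$ denotes their entries as functions of the parameters. *)

theory Defs
  imports "HOL-Analysis.Analysis"
begin

text \<open>
  Points of the parameter plane are vectors \<open>x :: real^2\<close> with \<open>x $ 1\<close> the density \<open>\<rho>\<close> and
  \<open>x $ 2\<close> the energy \<open>\<E>\<close>; likewise \<open>\<alpha> $ 1\<close> is \<open>\<alpha>\<^sub>p\<close> and \<open>\<alpha> $ 2\<close> is \<open>\<alpha>\<^sub>e\<close>.
\<close>

definition susceptibility :: "real \<Rightarrow> real \<Rightarrow> real \<Rightarrow> real^2^2" where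
  "susceptibility \<kappa> \<rho> \<E> = vector
     [vector [\<rho> * (1 - \<rho>), \<E> * (1 - \<rho>)],
      vector [\<E> * (1 - \<rho>),
              (\<E> - \<rho>) * (\<kappa> * \<rho> - \<E>) / ((\<kappa> - 1) * \<rho>) + (1 - \<rho>) * \<E>\<^sup>2 / \<rho>]]"

definition current :: "real \<Rightarrow> real^2 \<Rightarrow> real^2 \<Rightarrow> real^2" where
  "current \<kappa> \<alpha> x = (\<kappa> - 1) *\<^sub>R (susceptibility \<kappa> (x $ 1) (x $ 2) *v \<alpha>)"

definition gradient :: "(real^'n \<Rightarrow> real) \<Rightarrow> real^'n \<Rightarrow> real^'n" where
  "gradient f x = (\<chi> k. frechet_derivative f (at x) (axis k 1))"

definition hessian :: "(real^'n \<Rightarrow> real) \<Rightarrow> real^'n \<Rightarrow> real^'n^'n" where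
  "hessian f x = jacobian (gradient f) (at x)"

definition current_jacobian :: "real \<Rightarrow> real^2 \<Rightarrow> real^2 \<Rightarrow> real^2^2" where
  "current_jacobian \<kappa> \<alpha> x = jacobian (current \<kappa> \<alpha>) (at x)"

definition current_hessian :: "real \<Rightarrow> real^2 \<Rightarrow> real^2 \<Rightarrow> 2 \<Rightarrow> real^2^2" where
  "current_hessian \<kappa> \<alpha> x i = hessian (\<lambda>y. current \<kappa> \<alpha> y $ i) x"

text \<open>
  \<open>\<l> $ 1 > \<l> $ 2\<close> are the eigenvalues of \<open>A\<close>, and \<open>(\<cc> $ i, 1)\<close> is a left eigenvector for \<open>\<l> $ i\<close>.
  Given two distinct eigenvalues, \<open>\<cc>\<close> exists uniquely as soon as \<open>A $ 1 $ 2 \<noteq> 0\<close>; for the current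
  Jacobian with \<open>\<alpha> = (0, 1)\<close> that entry is \<open>(\<kappa> - 1) * (1 - \<rho>)\<close>.
\<close>

definition left_eigensystem :: "real^2^2 \<Rightarrow> real^2 \<Rightarrow> real^2 \<Rightarrow> bool" where
  "left_eigensystem A \<l> \<cc> \<longleftrightarrow>
     \<l> $ 1 > \<l> $ 2 \<and>
     (\<forall>i. vector [\<cc> $ i, 1] v* A = \<l> $ i *s (vector [\<cc> $ i, 1] :: real^2))"

definition left_coeffs :: "real^2^2 \<Rightarrow> real^2" where
  "left_coeffs A = (THE \<cc>. \<exists>\<l>. left_eigensystem A \<l> \<cc>)"

definition normal_mode_matrix :: "real^2 \<Rightarrow> real^2^2" where
  "normal_mode_matrix \<cc> = vector [vector [\<cc> $ 1, 1], vector [\<cc> $ 2, 1]]"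

definition coupling_matrix ::
    "real^2 \<Rightarrow> 2 \<Rightarrow> real \<Rightarrow> real \<Rightarrow> real \<Rightarrow> real^2^2" where
  "coupling_matrix \<alpha> i \<kappa> \<rho> \<E> =
     (let x = vector [\<rho>, \<E>];
          \<cc> = left_coeffs (current_jacobian \<kappa> \<alpha> x);
          S = matrix_inv (normal_mode_matrix \<cc>)
      in (1/2) *\<^sub>R
         (transpose S **
          (\<cc> $ i *\<^sub>R current_hessian \<kappa> \<alpha> x 1 + current_hessian \<kappa> \<alpha> x 2) ** S))"

end

theory Submission
  imports Defs
begin

text \<open>
  Write \<open>u = \<E> / \<rho>\<close> and let \<open>q\<close> be the quadratic polynomial with roots \<open>\<cc>\<^sub>1 > \<cc>\<^sub>2\<close> that is
  obtained by eliminating the eigenvalue from the left eigenvector equation. The key identity is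
  \<open>q(- u) = (u - 1) (u - \<kappa>)\<close>, which is negative for \<open>1 < u < \<kappa>\<close>: hence
  \<open>\<cc>\<^sub>2 < - u < \<cc>\<^sub>1\<close>, and \<open>\<cc>\<^sub>1 < 0\<close> because the coefficients of \<open>q\<close> are positive. Up to the
  factor \<open>(\<cc>\<^sub>1 - \<cc>\<^sub>2)\<^sup>2\<close>,
  \<open>G\<^sup>2\<^sub>2\<^sub>2 = (\<kappa> - 2) / \<rho> (u + \<cc>\<^sub>1)\<^sup>2 - (\<kappa> - 1) \<cc>\<^sub>1 (\<cc>\<^sub>1 - \<cc>\<^sub>2)\<close> is positive, while
  \<open>G\<^sup>1\<^sub>1\<^sub>1 = (\<kappa> - 2) / \<rho> (u + \<cc>\<^sub>2)\<^sup>2 + (\<kappa> - 1) \<cc>\<^sub>2 (\<cc>\<^sub>1 - \<cc>\<^sub>2)\<close> is positive at \<open>u = 1\<close> when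
  \<open>\<rho> < 1 - 2 / \<kappa>\<close> and negative for \<open>u\<close> close to \<open>\<kappa>\<close>, so it vanishes in between.
\<close>

section \<open>Jacobians, gradients and Hessians in the plane\<close>

lemma has_derivative_vec_nth [derivative_intros]:
  "(f has_derivative f') F \<Longrightarrow> ((\<lambda>x. f x $ i) has_derivative (\<lambda>h. f' h $ i)) F"
  by (rule bounded_linear.has_derivative[OF bounded_linear_vec_nth])

lemma jacobian_2:
  fixes F :: "real^2 \<Rightarrow> real^2"
  assumes "((\<lambda>y. F y $ 1) has_derivative (\<lambda>h. a * h $ 1 + b * h $ 2)) (at x)"
    and "((\<lambda>y. F y $ 2) has_derivative (\<lambda>h. c * h $ 1 + d * h $ 2)) (at x)"
  shows "jacobian F (at x) = vector [vector [a, b], vector [c, d]]"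
proof -
  have "(F has_derivative (\<lambda>h. vector [a * h $ 1 + b * h $ 2, c * h $ 1 + d * h $ 2])) (at x)"
    using assms by (subst has_derivative_componentwise_within)
      (auto simp: Basis_vec_def cart_eq_inner_axis[symmetric] forall_2 inner_axis)
  then have "frechet_derivative F (at x) = (\<lambda>h. vector [a * h $ 1 + b * h $ 2, c * h $ 1 + d * h $ 2])"
    by (rule frechet_derivative_at[symmetric])
  then show ?thesis
    by (simp add: jacobian_def matrix_def vec_eq_iff forall_2 axis_def)
qed

lemma gradient_2:
  fixes f :: "real^2 \<Rightarrow> real"
  assumes "(f has_derivative (\<lambda>h. a * h $ 1 + b * h $ 2)) (at x)"
  shows "gradient f x = vector [a, b]"
  using frechet_derivative_at[OF assms, symmetric]
  by (simp add: gradient_def vec_eq_iff forall_2 axis_def)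

text \<open>Second derivatives at \<open>x\<close> depend on the gradient near \<open>x\<close>, so
  the first hypothesis is local. This suits the current, whose closed form is valid only away from
  zero density.\<close>

lemma hessian_2:
  fixes f :: "real^2 \<Rightarrow> real"
  assumes "\<forall>\<^sub>F y in nhds x. (f has_derivative (\<lambda>h. f1 y * h $ 1 + f2 y * h $ 2)) (at y)"
    and "(f1 has_derivative (\<lambda>h. a * h $ 1 + b * h $ 2)) (at x)"
    and "(f2 has_derivative (\<lambda>h. c * h $ 1 + d * h $ 2)) (at x)"
  shows "hessian f x = vector [vector [a, b], vector [c, d]]"
proof -
  have ev: "\<forall>\<^sub>F y in nhds x. gradient f y = vector [f1 y, f2 y]"
    using assms(1) by (rule eventually_mono) (rule gradient_2)
  have ev': "\<forall>\<^sub>F y in at x. gradient f y = vector [f1 y, f2 y]"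
    using ev by (auto simp: eventually_at_filter elim: eventually_mono)
  have x: "gradient f x = vector [f1 x, f2 x]"
    by (rule eventually_nhds_x_imp_x[OF ev])
  show ?thesis
    unfolding hessian_def
  proof (rule jacobian_2)
    show "((\<lambda>y. gradient f y $ 1) has_derivative (\<lambda>h. a * h $ 1 + b * h $ 2)) (at x)"
      by (rule has_derivative_transform_eventually[where f = f1])
        (use assms(2) x in \<open>auto intro: eventually_mono[OF ev']\<close>)
    show "((\<lambda>y. gradient f y $ 2) has_derivative (\<lambda>h. c * h $ 1 + d * h $ 2)) (at x)"
      by (rule has_derivative_transform_eventually[where f = f2])
        (use assms(3) x in \<open>auto intro: eventually_mono[OF ev']\<close>)
  qed
qed

section \<open>Left eigenvectors of 2x2 matrices\<close>

lemma matrix_inv_normal_mode_matrix: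
  assumes "c $ 1 \<noteq> c $ 2"
  shows "matrix_inv (normal_mode_matrix c) =
    (1 / (c $ 1 - c $ 2)) *\<^sub>R vector [vector [1, - 1], vector [- c $ 2, c $ 1]]"
  (is "_ = ?S")
proof -
  let ?R = "normal_mode_matrix c"
  have S: "?R ** ?S = mat 1" "?S ** ?R = mat 1"
    using assms by (auto simp: normal_mode_matrix_def matrix_matrix_mult_def mat_def vec_eq_iff
      forall_2 sum_2 divide_simps)
  then have "invertible ?R" unfolding invertible_def by blast
  then have inv: "matrix_inv ?R ** ?R = mat 1"
    unfolding invertible_def matrix_inv_def by (rule someI_ex[THEN conjunct2])
  have "matrix_inv ?R = matrix_inv ?R ** (?R ** ?S)"
    unfolding S by simp
  also have "\<dots> = ?S"
    unfolding matrix_mul_assoc inv by simp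
  finally show ?thesis .
qed

lemma left_eigensystem_iff:
  "left_eigensystem A l c \<longleftrightarrow> l $ 1 > l $ 2 \<and>
     (\<forall>i. c $ i * A $ 1 $ 1 + A $ 2 $ 1 = l $ i * c $ i \<and> c $ i * A $ 1 $ 2 + A $ 2 $ 2 = l $ i)"
  by (simp add: left_eigensystem_def vec_eq_iff forall_2 vector_matrix_mult_def sum_2 mult.commute)

text \<open>The second column of the eigenvector equation gives
  \<open>l $ i = c $ i * A $ 1 $ 2 + A $ 2 $ 2\<close>. Substituted into the first, it makes each
  \<open>c $ i\<close> a root of the quadratic. Since \<open>A $ 1 $ 2 > 0\<close>, eigenvalues and
  coefficients are ordered alike, which settles the description by \<open>THE\<close>.\<close>

lemma left_coeffs_eqI:
  assumes "A $ 1 $ 2 > 0" and "c1 > c2"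
    and q: "A $ 1 $ 2 * c1\<^sup>2 + (A $ 2 $ 2 - A $ 1 $ 1) * c1 = A $ 2 $ 1"
           "A $ 1 $ 2 * c2\<^sup>2 + (A $ 2 $ 2 - A $ 1 $ 1) * c2 = A $ 2 $ 1"
  shows "left_coeffs A = vector [c1, c2]"
  unfolding left_coeffs_def
proof (rule the_equality)
  have "left_eigensystem A (vector [c1 * A $ 1 $ 2 + A $ 2 $ 2, c2 * A $ 1 $ 2 + A $ 2 $ 2]) (vector [c1, c2])"
    using assms by (auto simp: left_eigensystem_iff forall_2 power2_eq_square algebra_simps)
  then show "\<exists>l. left_eigensystem A l (vector [c1, c2])" ..
next
  fix c assume "\<exists>l. left_eigensystem A l c"
  then obtain l where l: "left_eigensystem A l c" ..
  have root: "c $ i = c1 \<or> c $ i = c2" for i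
  proof -
    let ?p = "A $ 2 $ 2 - A $ 1 $ 1"
    have "A $ 1 $ 2 * (c $ i)\<^sup>2 + ?p * c $ i = A $ 2 $ 1"
    proof -
      have "c $ i * A $ 1 $ 1 + A $ 2 $ 1 = (c $ i * A $ 1 $ 2 + A $ 2 $ 2) * c $ i"
        using l unfolding left_eigensystem_iff by metis
      then show ?thesis by (simp add: power2_eq_square algebra_simps)
    qed
    \<comment> \<open>Differences of root equations factor; cancelling \<open>c2 - c1\<close> in the
      second gives the sum of the roots, so the first becomes a product over both roots.\<close>
    with q have 1: "(c $ i - c1) * (A $ 1 $ 2 * (c $ i + c1) + ?p) = 0"
      and 2: "(c2 - c1) * (A $ 1 $ 2 * (c2 + c1) + ?p) = 0"
      by (auto simp: power2_eq_square algebra_simps)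
    from 2 \<open>c1 > c2\<close> have "A $ 1 $ 2 * (c2 + c1) + ?p = 0" by simp
    then have "A $ 1 $ 2 * (c $ i + c1) + ?p = A $ 1 $ 2 * (c $ i - c2)"
      by (simp add: algebra_simps)
    with 1 assms(1) show ?thesis by auto
  qed
  have "c $ 1 * A $ 1 $ 2 > c $ 2 * A $ 1 $ 2"
    using l unfolding left_eigensystem_iff by (smt (verit))
  then have "c $ 1 > c $ 2" using assms(1) by simp
  with root[of 1] root[of 2] assms(2) have "c $ 1 = c1 \<and> c $ 2 = c2" by auto
  then show "c = vector [c1, c2]" by (simp add: vec_eq_iff forall_2)
qed

section \<open>The current for \<alpha> = (0, 1) and its diagonal couplings\<close>

lemma current_1: "current k (vector [0, 1]) x $ 1 = (k - 1) * (x $ 2 * (1 - x $ 1))"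
  by (simp add: current_def susceptibility_def matrix_vector_mult_def sum_2)

lemma current_2:
  assumes "k \<noteq> 1" "x $ 1 \<noteq> 0"
  shows "current k (vector [0, 1]) x $ 2 =
    (k + 1) * x $ 2 - k * x $ 1 + (k - 2) * (x $ 2)\<^sup>2 / x $ 1 - (k - 1) * (x $ 2)\<^sup>2"
  using assms
  by (simp add: current_def susceptibility_def matrix_vector_mult_def sum_2 distrib_left)
    (simp add: divide_simps, simp add: power2_eq_square algebra_simps)

lemma has_derivative_current_1:
  "((\<lambda>y. current k (vector [0, 1]) y $ 1) has_derivative
     (\<lambda>h. - (k - 1) * x $ 2 * h $ 1 + (k - 1) * (1 - x $ 1) * h $ 2)) (at x)"
  unfolding current_1
  by (auto intro!: derivative_eq_intros simp: algebra_simps)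

lemma has_derivative_current_2:
  assumes "k \<noteq> 1" "x $ 1 > 0"
  shows "((\<lambda>y. current k (vector [0, 1]) y $ 2) has_derivative
     (\<lambda>h. (- k - (k - 2) * (x $ 2)\<^sup>2 / (x $ 1)\<^sup>2) * h $ 1 +
          (k + 1 + 2 * (k - 2) * x $ 2 / x $ 1 - 2 * (k - 1) * x $ 2) * h $ 2)) (at x)"
proof (rule has_derivative_transform_eventually)
  let ?f = "\<lambda>x::real^2. (k + 1) * x $ 2 - k * x $ 1 + (k - 2) * (x $ 2)\<^sup>2 / x $ 1 - (k - 1) * (x $ 2)\<^sup>2"
  show "(?f has_derivative 
     (\<lambda>h. (- k - (k - 2) * (x $ 2)\<^sup>2 / (x $ 1)\<^sup>2) * h $ 1 +
          (k + 1 + 2 * (k - 2) * x $ 2 / x $ 1 - 2 * (k - 1) * x $ 2) * h $ 2)) (at x)"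
    using assms
    by (auto intro!: derivative_eq_intros simp: field_simps power2_eq_square)
  have "open {y::real^2. y $ 1 > 0}"
    by (intro open_Collect_less continuous_intros)
  then have "\<forall>\<^sub>F y in at x. y $ 1 > 0"
    using assms eventually_at_topological by blast
  then show "\<forall>\<^sub>F y in at x. ?f y = current k (vector [0, 1]) y $ 2"
    by (rule eventually_mono) (use assms in \<open>simp add: current_2\<close>)
  show "?f x = current k (vector [0, 1]) x $ 2"
    using assms by (simp add: current_2)
qed simp

lemma current_jacobian_energy:
  assumes "k \<noteq> 1" "x $ 1 > 0"
  shows "current_jacobian k (vector [0, 1]) x = vector
    [vector [- (k - 1) * x $ 2, (k - 1) * (1 - x $ 1)],
     vector [- k - (k - 2) * (x $ 2)\<^sup>2 / (x $ 1)\<^sup>2,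
             k + 1 + 2 * (k - 2) * x $ 2 / x $ 1 - 2 * (k - 1) * x $ 2]]"
  unfolding current_jacobian_def
  by (intro jacobian_2 has_derivative_current_1 has_derivative_current_2 assms)

lemma current_hessian_1:
  "current_hessian k (vector [0, 1]) x 1 = vector [vector [0, - (k - 1)], vector [- (k - 1), 0]]"
  unfolding current_hessian_def
  by (rule hessian_2[OF eventuallyI[OF has_derivative_current_1]])
    (auto intro!: derivative_eq_intros simp: algebra_simps)

lemma current_hessian_2:
  assumes "k \<noteq> 1" "x $ 1 > 0"
  shows "current_hessian k (vector [0, 1]) x 2 = vector
    [vector [2 * (k - 2) * (x $ 2)\<^sup>2 / (x $ 1) ^ 3, - 2 * (k - 2) * x $ 2 / (x $ 1)\<^sup>2],
     vector [- 2 * (k - 2) * x $ 2 / (x $ 1)\<^sup>2, 2 * (k - 2) / x $ 1 - 2 * (k - 1)]]"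
  unfolding current_hessian_def
proof (rule hessian_2)
  have "open {y::real^2. y $ 1 > 0}"
    by (intro open_Collect_less continuous_intros)
  then have "\<forall>\<^sub>F y in nhds x. y $ 1 > 0"
    using assms eventually_nhds by blast
  then show "\<forall>\<^sub>F y in nhds x. ((\<lambda>y. current k (vector [0, 1]) y $ 2) has_derivative
     (\<lambda>h. (- k - (k - 2) * (y $ 2)\<^sup>2 / (y $ 1)\<^sup>2) * h $ 1 +
          (k + 1 + 2 * (k - 2) * y $ 2 / y $ 1 - 2 * (k - 1) * y $ 2) * h $ 2)) (at y)"
    by (rule eventually_mono) (rule has_derivative_current_2[OF assms(1)])
qed (use assms in \<open>auto intro!: derivative_eq_intros
    simp: field_simps power2_eq_square power3_eq_cube power4_eq_xxxx\<close>)

text \<open>With \<open>u = \<E> / \<rho>\<close>, the term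
  \<open>(k - 2) \<E>\<^sup>2 / \<rho>\<close> of the current has the rank-one Hessian
  \<open>2 (k - 2) / \<rho>\<close> times the outer square of \<open>(u, -1)\<close>. Evaluated on
  the columns \<open>(1, -c2)\<close> and \<open>(-1, c1)\<close> of the inverse, up to scale, it
  gives the squares; the remaining entries give the terms with \<open>k - 1\<close>.\<close>

lemma coupling_matrix_diagonal:
  assumes "k \<noteq> 1" "\<rho> > 0" "c1 \<noteq> c2"
    and c: "left_coeffs (current_jacobian k (vector [0, 1]) (vector [\<rho>, \<E>])) = vector [c1, c2]"
  shows "coupling_matrix (vector [0, 1]) 1 k \<rho> \<E> $ 1 $ 1 =
      ((k - 2) / \<rho> * (\<E> / \<rho> + c2)\<^sup>2 + (k - 1) * c2 * (c1 - c2)) / (c1 - c2)\<^sup>2" (is ?t1)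
    and "coupling_matrix (vector [0, 1]) 2 k \<rho> \<E> $ 2 $ 2 =
      ((k - 2) / \<rho> * (\<E> / \<rho> + c1)\<^sup>2 - (k - 1) * c1 * (c1 - c2)) / (c1 - c2)\<^sup>2" (is ?t2)
proof -
  define d where "d = 1 / (c1 - c2)"
  have S: "matrix_inv (normal_mode_matrix (vector [c1, c2])) =
      d *\<^sub>R vector [vector [1, - 1], vector [- c2, c1]]"
    using matrix_inv_normal_mode_matrix[of "vector [c1, c2]"] assms(3) by (simp add: d_def)
  have H: "current_hessian k (vector [0, 1]) (vector [\<rho>, \<E>]) 2 = vector
    [vector [2 * (k - 2) / \<rho> * (\<E> / \<rho>)\<^sup>2, - 2 * (k - 2) / \<rho> * (\<E> / \<rho>)],
     vector [- 2 * (k - 2) / \<rho> * (\<E> / \<rho>), 2 * (k - 2) / \<rho> - 2 * (k - 1)]]"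
    using current_hessian_2[of k "vector [\<rho>, \<E>]"] assms
    by (simp add: power2_eq_square power3_eq_cube mult.assoc)
  have D: "x / (c1 - c2)\<^sup>2 = x * d\<^sup>2" for x
    by (simp add: d_def power_one_over divide_inverse power_inverse)
  show ?t1 ?t2
    unfolding D coupling_matrix_def Let_def c S H current_hessian_1
    by (simp_all add: matrix_matrix_mult_def transpose_def sum_2 power2_eq_square algebra_simps
        add_divide_distrib diff_divide_distrib)
qed

section \<open>The coefficients as roots of a quadratic\<close>

text \<open>
  The coefficients \<open>\<cc>\<^sub>1 > \<cc>\<^sub>2\<close> are the roots of
  \<open>b c\<^sup>2 + p c + n\<close>, where \<open>b = (\<kappa> - 1) (1 - \<rho>)\<close>, \<open>n = \<kappa> + (\<kappa> - 2) (\<E> / \<rho>)\<^sup>2\<close>, and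
  \<open>p\<close> is \<open>charpoly_lin\<close>; \<open>mode_coeff \<sigma>\<close> with \<open>\<sigma> = 1\<close> and \<open>\<sigma> = - 1\<close> gives \<open>\<cc>\<^sub>1\<close> and \<open>\<cc>\<^sub>2\<close>.
\<close>

definition charpoly_lin :: "real \<Rightarrow> real \<Rightarrow> real \<Rightarrow> real" where
  "charpoly_lin k \<rho> \<E> = k + 1 + 2 * (k - 2) * \<E> / \<rho> - (k - 1) * \<E>"

definition charpoly_disc :: "real \<Rightarrow> real \<Rightarrow> real \<Rightarrow> real" where
  "charpoly_disc k \<rho> \<E> =
    (charpoly_lin k \<rho> \<E>)\<^sup>2 - 4 * ((k - 1) * (1 - \<rho>)) * (k + (k - 2) * (\<E> / \<rho>)\<^sup>2)"

definition mode_coeff :: "real \<Rightarrow> real \<Rightarrow> real \<Rightarrow> real \<Rightarrow> real" where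
  "mode_coeff \<sigma> k \<rho> \<E> =
    (- charpoly_lin k \<rho> \<E> + \<sigma> * sqrt (charpoly_disc k \<rho> \<E>)) / (2 * ((k - 1) * (1 - \<rho>)))"

text \<open>For a quadratic \<open>q\<close> with leading coefficient \<open>b\<close>, the
  discriminant is \<open>q'(z)\<^sup>2 - 4 b q(z)\<close> at every \<open>z\<close>; here
  \<open>z = - \<E> / \<rho>\<close>.\<close>

lemma charpoly_disc_eq:
  assumes "\<rho> > 0"
  shows "charpoly_disc k \<rho> \<E> = (charpoly_lin k \<rho> \<E> - 2 * ((k - 1) * (1 - \<rho>)) * (\<E> / \<rho>))\<^sup>2
    + 4 * ((k - 1) * (1 - \<rho>)) * ((\<E> / \<rho> - 1) * (k - \<E> / \<rho>))"
proof -
  define u where "u = \<E> / \<rho>"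
  have "charpoly_lin k \<rho> \<E> = k + 1 + 2 * (k - 2) * u - (k - 1) * (\<rho> * u)"
    using assms by (simp add: charpoly_lin_def u_def)
  then show ?thesis
    unfolding charpoly_disc_def u_def[symmetric]
    by (simp only:) (simp add: power2_eq_square algebra_simps)
qed

lemma mode_coeff_bounds:
  assumes "k > 2" "0 < \<rho>" "\<rho> < 1" "\<rho> < \<E>" "\<E> < k * \<rho>"
  shows "mode_coeff (-1) k \<rho> \<E> < - (\<E> / \<rho>)" "- (\<E> / \<rho>) < mode_coeff 1 k \<rho> \<E>"
    "mode_coeff 1 k \<rho> \<E> < 0" "charpoly_disc k \<rho> \<E> > 0"
proof -
  define b p u s where "b = (k - 1) * (1 - \<rho>)" and "p = charpoly_lin k \<rho> \<E>" and "u = \<E> / \<rho>"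
    and "s = sqrt (charpoly_disc k \<rho> \<E>)"
  have b: "b > 0" using assms by (simp add: b_def)
  have u: "1 < u" "u < k" and E: "\<E> = \<rho> * u"
    using assms by (auto simp: u_def field_simps)
  have pos: "4 * b * ((u - 1) * (k - u)) > 0"
    using b u by simp
  then have D: "(p - 2 * b * u)\<^sup>2 < charpoly_disc k \<rho> \<E>"
    using charpoly_disc_eq[OF assms(2)] by (simp add: b_def p_def u_def)
  then show "charpoly_disc k \<rho> \<E> > 0"
    by (smt (verit) zero_le_power2)
  have "\<bar>p - 2 * b * u\<bar> < s"
    using D real_less_rsqrt[of "\<bar>p - 2 * b * u\<bar>"] by (simp add: s_def)
  with b show "mode_coeff (-1) k \<rho> \<E> < - (\<E> / \<rho>)" "- (\<E> / \<rho>) < mode_coeff 1 k \<rho> \<E>"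
    unfolding mode_coeff_def b_def[symmetric] u_def[symmetric] p_def[symmetric] s_def[symmetric]
    by (auto simp: field_simps)
  \<comment> \<open>Isolating \<open>b * u\<close> leaves a remainder that exceeds
    \<open>k + 1 - u > 1\<close>.\<close>
  have "p = k + 1 + (k - 3) * u + b * u"
    using assms by (simp add: p_def charpoly_lin_def b_def E field_simps)
  moreover have "(k - 3) * u > - u" using assms(1) u by (simp add: algebra_simps)
  ultimately have "p > 0"
    using b u mult_pos_pos[of b u] by linarith
  moreover have "charpoly_disc k \<rho> \<E> < p\<^sup>2"
    using assms b by (simp add: charpoly_disc_def p_def b_def add_pos_nonneg)
  ultimately have "s < p"
    unfolding s_def by (metis abs_of_pos real_sqrt_abs real_sqrt_less_iff)
  with b show "mode_coeff 1 k \<rho> \<E> < 0"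
    unfolding mode_coeff_def b_def[symmetric] p_def[symmetric] s_def[symmetric]
    by (simp add: divide_less_0_iff)
qed

lemma left_coeffs_current_jacobian:
  assumes "k > 2" "0 < \<rho>" "\<rho> < 1" "\<rho> < \<E>" "\<E> < k * \<rho>"
  shows "left_coeffs (current_jacobian k (vector [0, 1]) (vector [\<rho>, \<E>])) =
    vector [mode_coeff 1 k \<rho> \<E>, mode_coeff (-1) k \<rho> \<E>]"
proof -
  define a b p n where "a = (k - 1) * \<E>" and "b = (k - 1) * (1 - \<rho>)" and "p = charpoly_lin k \<rho> \<E>"
    and "n = k + (k - 2) * (\<E> / \<rho>)\<^sup>2"
  have J: "current_jacobian k (vector [0, 1]) (vector [\<rho>, \<E>]) = vector
    [vector [- a, b], vector [- n, p - a]]"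
    using assms by (simp add: current_jacobian_energy a_def b_def p_def n_def charpoly_lin_def power_divide vec_eq_iff
      forall_2 algebra_simps)
  have b: "b > 0" using assms by (simp add: b_def)
  have root: "b * (mode_coeff \<sigma> k \<rho> \<E>)\<^sup>2 + p * mode_coeff \<sigma> k \<rho> \<E> = - n" if "\<sigma>\<^sup>2 = 1" for \<sigma>
  proof -
    define s where "s = sqrt (charpoly_disc k \<rho> \<E>)"
    have "s\<^sup>2 = p\<^sup>2 - 4 * b * n"
      using mode_coeff_bounds(4)[OF assms] by (simp add: s_def charpoly_disc_def p_def b_def n_def)
    moreover have c: "mode_coeff \<sigma> k \<rho> \<E> = (- p + \<sigma> * s) / (2 * b)"
      by (simp add: mode_coeff_def s_def p_def b_def)
    then have "2 * b * mode_coeff \<sigma> k \<rho> \<E> + p = \<sigma> * s" using b by simp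
    then have "(2 * b * mode_coeff \<sigma> k \<rho> \<E> + p)\<^sup>2 = s\<^sup>2" using that by (simp add: power_mult_distrib)
    ultimately have "4 * b * (b * (mode_coeff \<sigma> k \<rho> \<E>)\<^sup>2 + p * mode_coeff \<sigma> k \<rho> \<E> + n) = 0"
      by (simp add: power2_eq_square algebra_simps)
    with b show ?thesis by simp
  qed
  show ?thesis
    unfolding J using b root[of 1] root[of "-1"] mode_coeff_bounds(1,2)[OF assms]
    by (intro left_coeffs_eqI) simp_all
qed

section \<open>Sign change of the numerator of \<open>G\<^sup>1\<^sub>1\<^sub>1\<close>\<close>

definition coupling_numerator :: "real \<Rightarrow> real \<Rightarrow> real \<Rightarrow> real" where
  "coupling_numerator k \<rho> \<E> = (k - 2) / \<rho> * (\<E> / \<rho> + mode_coeff (-1) k \<rho> \<E>)\<^sup>2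
    + (k - 1) * mode_coeff (-1) k \<rho> \<E> * (mode_coeff 1 k \<rho> \<E> - mode_coeff (-1) k \<rho> \<E>)"

text \<open>Meant for the endpoints \<open>\<E> = \<rho>\<close> and
  \<open>\<E> = k * \<rho>\<close>, where the second summand in \<open>charpoly_disc_eq\<close>
  vanishes and the discriminant is a perfect square.\<close>

lemma mode_coeff_eqI:
  assumes "k > 1" "charpoly_lin k \<rho> \<E> = (k - 1) * p" "charpoly_disc k \<rho> \<E> = ((k - 1) * t)\<^sup>2" "t \<ge> 0"
  shows "mode_coeff \<sigma> k \<rho> \<E> = (\<sigma> * t - p) / (2 * (1 - \<rho>))"
proof -
  have s: "sqrt (charpoly_disc k \<rho> \<E>) = (k - 1) * t"
    unfolding assms(3) using assms(1,4) by (intro real_sqrt_unique) simp_all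
  have "mode_coeff \<sigma> k \<rho> \<E> = ((k - 1) * (\<sigma> * t - p)) / ((k - 1) * (2 * (1 - \<rho>)))"
    unfolding mode_coeff_def assms(2) s by (simp add: algebra_simps)
  also have "\<dots> = (\<sigma> * t - p) / (2 * (1 - \<rho>))"
    using assms(1) by (intro mult_divide_mult_cancel_left) simp
  finally show ?thesis .
qed

lemma coupling_numerator_left_pos:
  assumes "k > 2" "0 < \<rho>" "\<rho> < 1 - 2 / k"
  shows "coupling_numerator k \<rho> \<rho> > 0"
proof -
  have r: "\<rho> < 1" using assms by (smt (verit) divide_pos_pos)
  have l: "charpoly_lin k \<rho> \<rho> = (k - 1) * (3 - \<rho>)"
    using assms by (simp add: charpoly_lin_def field_simps)
  have d: "charpoly_disc k \<rho> \<rho> = ((k - 1) * (1 + \<rho>))\<^sup>2"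
    using assms by (simp add: charpoly_disc_def l power2_eq_square algebra_simps)
  have c: "mode_coeff \<sigma> k \<rho> \<rho> = (\<sigma> * (1 + \<rho>) - (3 - \<rho>)) / (2 * (1 - \<rho>))" for \<sigma>
    using assms by (intro mode_coeff_eqI l d) simp_all
  have c1: "mode_coeff 1 k \<rho> \<rho> = - 1" and c2: "mode_coeff (-1) k \<rho> \<rho> = - 2 / (1 - \<rho>)"
    using r by (simp_all add: c field_simps)
  \<comment> \<open>The factor \<open>(k - 2) - k * \<rho>\<close> is positive exactly when \<rho> <
    1 - 2 / k.\<close>
  have "coupling_numerator k \<rho> \<rho> = (1 + \<rho>) * ((k - 2) - k * \<rho>) / (\<rho> * (1 - \<rho>)\<^sup>2)"
    using assms r unfolding coupling_numerator_def c1 c2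
    by (simp add: divide_simps) (simp add: power2_eq_square algebra_simps)
  moreover have "k * \<rho> < k - 2"
    using assms by (simp add: field_simps)
  ultimately show ?thesis using assms r by simp
qed

text \<open>
  At \<open>\<E> = \<kappa> \<rho>\<close> the two roots are \<open>- \<kappa>\<close> and \<open>- (\<kappa> - 1) / (1 - \<rho>)\<close>, which coincide for
  \<open>\<kappa> \<rho> = 1\<close>, so the numerator itself may vanish there. The expression below stays negative in
  every case; multiplied by \<open>\<cc>\<^sub>1 - \<cc>\<^sub>2\<close> it bounds the numerator from above in the interior.
\<close>

lemma coupling_bound_right_neg:
  assumes "k > 2" "0 < \<rho>" "\<rho> < 1"
  defines "c \<equiv> mode_coeff (-1) k \<rho> (k * \<rho>)"
  shows "(k - 1) * c - (k - 2) / \<rho> * (k + c) < 0"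
proof -
  have l: "charpoly_lin k \<rho> (k * \<rho>) = (k - 1) * (k - 1 + k * (1 - \<rho>))"
    using assms by (simp add: charpoly_lin_def field_simps)
  have d: "charpoly_disc k \<rho> (k * \<rho>) = ((k - 1) * \<bar>k * \<rho> - 1\<bar>)\<^sup>2"
    using assms by (simp add: charpoly_disc_def l power_mult_distrib)
      (simp add: power2_eq_square algebra_simps)
  have c: "c = (- 1 * \<bar>k * \<rho> - 1\<bar> - (k - 1 + k * (1 - \<rho>))) / (2 * (1 - \<rho>))"
    unfolding c_def using assms by (intro mode_coeff_eqI l d) simp_all
  show ?thesis
  \<comment> \<open>The two roots exchange their order at \<open>k * \<rho> = 1\<close>, and
    \<open>c\<close> is the smaller one.\<close>
  proof (cases "k * \<rho> \<le> 1")
    case True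
    then have "c = - k" using assms(3) by (simp add: c field_simps)
    with assms(1) show ?thesis by (simp add: mult_pos_neg)
  next
    case False
    then have c': "c = - (k - 1) / (1 - \<rho>)" using assms(3) by (simp add: c field_simps)
    have "(k - 1) * c - (k - 2) / \<rho> * (k + c) = - (\<rho> + k - 2) / (\<rho> * (1 - \<rho>))"
      unfolding c' using assms(2,3) by (simp add: divide_simps) (simp add: power2_eq_square algebra_simps)
    with assms(1-3) show ?thesis by (simp add: divide_less_0_iff)
  qed
qed

lemma continuous_on_mode_coeff:
  assumes "k \<noteq> 1" "\<rho> \<noteq> 0" "\<rho> \<noteq> 1"
  shows "continuous_on S (mode_coeff \<sigma> k \<rho>)"
  unfolding mode_coeff_def charpoly_disc_def charpoly_lin_def
  using assms by (intro continuous_intros) auto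

lemma coupling_numerator_neg:
  assumes "k > 2" "0 < \<rho>" "\<rho> < 1"
  obtains \<E> where "\<rho> < \<E>" "\<E> < k * \<rho>" "coupling_numerator k \<rho> \<E> < 0"
proof -
  define f where "f \<E> = (k - 1) * mode_coeff (-1) k \<rho> \<E>
    - (k - 2) / \<rho> * (\<E> / \<rho> + mode_coeff (-1) k \<rho> \<E>)" for \<E>
  have "continuous_on UNIV f"
    unfolding f_def using assms by (intro continuous_intros continuous_on_mode_coeff) auto
  \<comment> \<open>Left continuity carries the strict sign at the endpoint into the open interval,
    where the roots are distinct.\<close>
  then have "(f \<longlongrightarrow> f (k * \<rho>)) (at_left (k * \<rho>))"
    by (simp add: continuous_on_def filterlim_at_split)
  moreover have "f (k * \<rho>) < 0"
    using coupling_bound_right_neg[OF assms] assms by (simp add: f_def)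
  ultimately have "\<forall>\<^sub>F \<E> in at_left (k * \<rho>). f \<E> < 0"
    by (rule order_tendstoD)
  moreover have "\<forall>\<^sub>F \<E> in at_left (k * \<rho>). \<E> \<in> {\<rho><..<k * \<rho>}"
    using assms by (intro eventually_at_left_real) simp
  ultimately have "\<forall>\<^sub>F \<E> in at_left (k * \<rho>). f \<E> < 0 \<and> \<E> \<in> {\<rho><..<k * \<rho>}"
    by (rule eventually_conj)
  then obtain \<E> where E: "f \<E> < 0" "\<rho> < \<E>" "\<E> < k * \<rho>"
    using eventually_happens'[OF trivial_limit_at_left_real] by force
  define c1 c2 u w where "c1 = mode_coeff 1 k \<rho> \<E>" and "c2 = mode_coeff (-1) k \<rho> \<E>"
    and "u = \<E> / \<rho>" and "w = (k - 2) / \<rho>"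
  have c: "c2 < - u" "- u < c1"
    using mode_coeff_bounds(1,2)[OF assms E(2,3)] by (simp_all add: c1_def c2_def u_def)
  \<comment> \<open>As \<open>0 < - (u + c2) < c1 - c2\<close>, one factor of the square can be
    replaced by \<open>c1 - c2\<close>, which then becomes a common factor of the bound.\<close>
  have "(u + c2)\<^sup>2 \<le> (c1 - c2) * - (u + c2)"
    using mult_right_mono[of "- (u + c2)" "c1 - c2" "- (u + c2)"] c
    by (simp add: power2_eq_square algebra_simps)
  then have "w * (u + c2)\<^sup>2 \<le> w * ((c1 - c2) * - (u + c2))"
    using assms unfolding w_def by (intro mult_left_mono) auto
  moreover have f: "f \<E> = (k - 1) * c2 - w * (u + c2)"
    by (simp add: f_def c2_def u_def w_def)
  moreover have "(c1 - c2) * f \<E> = w * ((c1 - c2) * - (u + c2)) + (k - 1) * c2 * (c1 - c2)"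
    unfolding f by (simp add: algebra_simps)
  ultimately have "coupling_numerator k \<rho> \<E> \<le> (c1 - c2) * f \<E>"
    by (simp add: coupling_numerator_def c1_def c2_def u_def w_def)
  also have "\<dots> < 0" using c E(1) by (intro mult_pos_neg) auto
  finally show ?thesis using E that by blast
qed

theorem proposition47:
  fixes \<alpha>\<^sub>p \<alpha>\<^sub>e :: real and \<kappa> :: int
  assumes "(\<alpha>\<^sub>p, \<alpha>\<^sub>e) = (0, 1)" and "\<kappa> > 2"
  shows "(\<forall>\<rho>::real. \<forall>\<E>::real. 0 < \<rho> \<and> \<rho> < 1 \<and> \<rho> < \<E> \<and> \<E> < real_of_int \<kappa> * \<rho> \<longrightarrow>
            coupling_matrix (vector [\<alpha>\<^sub>p, \<alpha>\<^sub>e]) 2 (real_of_int \<kappa>) \<rho> \<E> $ 2 $ 2 > 0) \<and>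
         (\<forall>\<rho>::real. 0 < \<rho> \<and> \<rho> < 1 - 2 / real_of_int \<kappa> \<longrightarrow>
            (\<exists>\<E>'::real. \<rho> < \<E>' \<and> \<E>' < real_of_int \<kappa> * \<rho> \<and>
               coupling_matrix (vector [\<alpha>\<^sub>p, \<alpha>\<^sub>e]) 1 (real_of_int \<kappa>) \<rho> \<E>' $ 1 $ 1 = 0))"
proof (intro conjI allI impI)
  define k where "k = real_of_int \<kappa>"
  have k: "k > 2" using assms(2) by (simp add: k_def)
  have \<alpha>: "\<alpha>\<^sub>p = 0" "\<alpha>\<^sub>e = 1" using assms(1) by auto
  {
    fix \<rho> \<E> :: real
    assume "0 < \<rho> \<and> \<rho> < 1 \<and> \<rho> < \<E> \<and> \<E> < real_of_int \<kappa> * \<rho>"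
    then have h: "0 < \<rho>" "\<rho> < 1" "\<rho> < \<E>" "\<E> < k * \<rho>" by (auto simp: k_def)
    note c = mode_coeff_bounds[OF k h]
    define c1 c2 where "c1 = mode_coeff 1 k \<rho> \<E>" and "c2 = mode_coeff (-1) k \<rho> \<E>"
    have c': "c2 < c1" "c1 < 0" using c(1-3) unfolding c1_def c2_def by linarith+
    have "(k - 1) * c1 * (c1 - c2) < 0"
      using k c' by (simp add: mult_neg_pos mult_pos_neg)
    moreover have "(k - 2) / \<rho> * (\<E> / \<rho> + c1)\<^sup>2 \<ge> 0"
      using k h by simp
    moreover have "coupling_matrix (vector [0, 1]) 2 k \<rho> \<E> $ 2 $ 2 =
      ((k - 2) / \<rho> * (\<E> / \<rho> + c1)\<^sup>2 - (k - 1) * c1 * (c1 - c2)) / (c1 - c2)\<^sup>2"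
      using k h c' left_coeffs_current_jacobian[OF k h]
      by (intro coupling_matrix_diagonal) (auto simp: c1_def c2_def)
    ultimately show "coupling_matrix (vector [\<alpha>\<^sub>p, \<alpha>\<^sub>e]) 2 (real_of_int \<kappa>) \<rho> \<E> $ 2 $ 2 > 0"
      using c' by (simp add: \<alpha> flip: k_def)
  next
    fix \<rho> :: real
    assume "0 < \<rho> \<and> \<rho> < 1 - 2 / real_of_int \<kappa>"
    then have h: "0 < \<rho>" "\<rho> < 1 - 2 / k" by (auto simp: k_def)
    then have r: "\<rho> < 1" using k by (smt (verit) divide_pos_pos)
    obtain E1 where E1: "\<rho> < E1" "E1 < k * \<rho>" "coupling_numerator k \<rho> E1 < 0"
      using coupling_numerator_neg[OF k h(1) r] .
    have pos: "coupling_numerator k \<rho> \<rho> > 0"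
      by (rule coupling_numerator_left_pos[OF k h])
    have "continuous_on {\<rho>..E1} (coupling_numerator k \<rho>)"
      unfolding coupling_numerator_def
      using k h r by (intro continuous_intros continuous_on_mode_coeff) auto
    then obtain \<E> where E: "\<rho> \<le> \<E>" "\<E> \<le> E1" "coupling_numerator k \<rho> \<E> = 0"
      using IVT2'[of "coupling_numerator k \<rho>" E1 0 \<rho>] E1 pos by auto
    \<comment> \<open>The zero cannot be \<rho>, where the numerator is positive, and it is at most
      \<open>E1 < k * \<rho>\<close>.\<close>
    have E': "\<rho> < \<E>" "\<E> < k * \<rho>"
      using E E1 pos by (auto simp: less_le)
    have "coupling_matrix (vector [0, 1]) 1 k \<rho> \<E> $ 1 $ 1 = 0"
      using k h E(3) mode_coeff_bounds(1,2)[OF k h(1) r E']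
      by (subst coupling_matrix_diagonal(1)[OF _ _ _ left_coeffs_current_jacobian[OF k h(1) r E']])
        (auto simp: coupling_numerator_def)
    with E' show "\<exists>\<E>'. \<rho> < \<E>' \<and> \<E>' < real_of_int \<kappa> * \<rho> \<and>
        coupling_matrix (vector [\<alpha>\<^sub>p, \<alpha>\<^sub>e]) 1 (real_of_int \<kappa>) \<rho> \<E>' $ 1 $ 1 = 0"
      by (auto simp: \<alpha> simp flip: k_def)
  }
qed
end
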